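(* Let $\mathcal{D}=\{t_1,\dots,t_n\}\subset\mathbb{R}^d$, let $\pi$ be a ranking over $\mathcal{D}$, and let $g,k$ be positive integers. If the $g$-Group Bonus Linear Ranking instance $(\mathcal{D},\pi,g,k)$ has a satisfying solution, then algorithm MGRA returns a vector $w\in\mathbb{R}^d$, values $v_1,\dots,v_g\in\mathbb{R}^+$ and pairwise disjoint sets $G_1,\dots,G_g\subseteq\mathcal{D}$ with $\sum_{i\in[g]}|G_i|\le k$ which satisfy the problem, i.e., sorting the tuples in decreasing order of $s_w(t)+v_r$ for $t\in G_r$ and $s_w(t)$ for $t\notin\bigcup_r G_r$ produces $\pi$.
   Context: For $w\in\mathbb{R}^d$, $s_w(t)=\sum_{j=1}^d w_j t[j]$. The $g$-Group Bonus Linear Ranking problem: given $(\mathcal{D},\pi,g,k)$, decide whether there exist $w\in\mathbb{R}^d$, bonus values $v_1,\dots,v_g\in\mathbb{R}^+$ and pairwise disjoint subsets $G_1,\dots,G_g\subseteq\mathcal{D}$ with $\sum_{i}|G_i|\le k$ such that the ranking $\pi$ is obtained by sorting tuples in decreasing order of the score $s_w(t)$ plus $v_r$ if $t\in G_r$ (no bonus for tuples in no group). Algorithm MGRA: (1) for every tuple $t_j$ create $g+1$ copies in $\mathbb{R}^{d+g}$: $t_j^{(0)}=(t_j,0,\dots,0)$ and, for $i=1,\dots,g$, $t_j^{(i)}$ equal to $t_j$ on the first $d$ coordinates with coordinate $d+i$ equal to $1$ and the other last coordinates $0$; (2) form the comparison hyperplanes $\{w: w\cdot a=w\cdot b\}$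 for all pairs of these $n(g+1)$ points and enumerate the cells of their arrangement, each inducing a ranking $\rho$ of the copies; (3) for each $\rho$ compute a budgeted longest common subsequence of $\rho$ and $\pi$ in which an entry $p$ of $\pi$ may be matched to any copy $p^{(\ell)}$ in $\rho$, with at most $k$ matches to copies with $\ell\ge1$; (4) output the weight vector (first $d$ coordinates), bonus values (last $g$ coordinates) and groups ($G_\ell$ = tuples matched to their copy $\ell\ge1$) for the best ranking.
   Formalization: MGRA is taken to search only the cells whose last g coordinates (the bonus values) are positive; over all cells the claim fails, e.g. for a single tuple a cell with a negative bonus value is also best and may be returned. *)

theory Defs
  imports "HOL-Analysis.Analysis" "HOL-Library.Sublist" "HOL-Library.Disjoint_Sets"
begin

definition ranking_over :: "'a set \<Rightarrow> 'a list \<Rightarrow> bool" where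
  "ranking_over A xs \<longleftrightarrow> set xs = A \<and> distinct xs"

text \<open>Tuples have to be separated strictly by their scores. If ties could be broken
  arbitrarily, the zero weight vector would produce every ranking.\<close>

definition sorting_produces :: "('a \<Rightarrow> real) \<Rightarrow> 'a set \<Rightarrow> 'a list \<Rightarrow> bool" where
  "sorting_produces f A xs \<longleftrightarrow> ranking_over A xs \<and> sorted_wrt (\<lambda>x y. f x > f y) xs"

definition score :: "real ^ 'd \<Rightarrow> real ^ 'd \<Rightarrow> real" where
  "score w t = (\<Sum>j\<in>UNIV. w $ j * t $ j)"

text \<open>For pairwise disjoint groups the sum has at most one term.\<close>

definition bonus_score ::
    "real ^ 'd \<Rightarrow> real ^ 'g \<Rightarrow> ('g \<Rightarrow> (real ^ 'd) set) \<Rightarrow> real ^ 'd \<Rightarrow> real" where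
  "bonus_score w v G t = score w t + (\<Sum>r | t \<in> G r. v $ r)"

text \<open>The dimension \<open>d\<close> and the number of groups \<open>g\<close> are the cardinalities of the
  index types \<open>'d\<close> and \<open>'g\<close>.\<close>

definition group_bonus_solution ::
    "(real ^ 'd) set \<Rightarrow> (real ^ 'd) list \<Rightarrow> nat \<Rightarrow>
     real ^ 'd \<Rightarrow> real ^ 'g \<Rightarrow> ('g \<Rightarrow> (real ^ 'd) set) \<Rightarrow> bool" where
  "group_bonus_solution D \<pi> k w v G \<longleftrightarrow>
     (\<forall>i. v $ i > 0) \<and>
     (\<forall>i. G i \<subseteq> D) \<and> disjoint_family G \<and> (\<Sum>i\<in>UNIV. card (G i)) \<le> k \<and>
     sorting_produces (bonus_score w v G) D \<pi>"

text \<open>The copy labelled \<open>None\<close> is \<open>t\<^sup>(\<^sup>0\<^sup>)\<close>; in \<open>\<real>\<^sup>d\<^sup>+\<^sup>g\<close> the coordinates \<open>Inl j\<close> are the first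
  \<open>d\<close> and the coordinates \<open>Inr i\<close> the last \<open>g\<close>.\<close>

definition tuple_copy :: "real ^ 'd \<Rightarrow> 'g option \<Rightarrow> real ^ ('d::finite + 'g::finite)" where
  "tuple_copy t l =
     (\<chi> c. case c of Inl j \<Rightarrow> t $ j | Inr i \<Rightarrow> (if l = Some i then 1 else 0))"

definition tuple_copies :: "(real ^ 'd) set \<Rightarrow> (real ^ ('d::finite + 'g::finite)) set" where
  "tuple_copies D = {tuple_copy t l | t l. t \<in> D}"

definition comparison_hyperplanes :: "(real ^ ('d::finite + 'g::finite)) set \<Rightarrow> (real ^ ('d::finite + 'g::finite)) set set" where
  "comparison_hyperplanes A = {{u. u \<bullet> a = u \<bullet> b} | a b. a \<in> A \<and> b \<in> A \<and> a \<noteq> b}"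

definition arrangement_cells :: "(real ^ 'm) set set \<Rightarrow> (real ^ 'm) set set" where
  "arrangement_cells H = components (UNIV - \<Union>H)"

definition induced_ranking ::
    "(real ^ 'm) set \<Rightarrow> (real ^ 'm) set \<Rightarrow> (real ^ 'm) list \<Rightarrow> bool" where
  "induced_ranking A C \<rho> \<longleftrightarrow> (\<forall>u\<in>C. sorting_produces (\<lambda>a. u \<bullet> a) A \<rho>)"

text \<open>A list of pairs \<open>(p, l)\<close> stands for a common subsequence in which the entry \<open>p\<close> of
  \<open>\<pi>\<close> is matched to its copy with label \<open>l\<close> in \<open>\<rho>\<close>.\<close>

definition budgeted_common_subseq ::
    "nat \<Rightarrow> (real ^ 'd) list \<Rightarrow> (real ^ ('d::finite + 'g::finite)) list \<Rightarrow>
     ((real ^ 'd) \<times> 'g option) list \<Rightarrow> bool" where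
  "budgeted_common_subseq k \<pi> \<rho> m \<longleftrightarrow>
     subseq (map fst m) \<pi> \<and> subseq (map (\<lambda>(p, l). tuple_copy p l) m) \<rho> \<and>
     length (filter (\<lambda>(p, l). l \<noteq> None) m) \<le> k"

definition budgeted_lcs ::
    "nat \<Rightarrow> (real ^ 'd) list \<Rightarrow> (real ^ ('d::finite + 'g::finite)) list \<Rightarrow>
     ((real ^ 'd) \<times> 'g option) list \<Rightarrow> bool" where
  "budgeted_lcs k \<pi> \<rho> m \<longleftrightarrow> budgeted_common_subseq k \<pi> \<rho> m \<and>
     (\<forall>m'. budgeted_common_subseq k \<pi> \<rho> m' \<longrightarrow> length m' \<le> length m)"

text \<open>A run on one cell, with a representative \<open>u\<close> of the cell, the ranking \<open>\<rho>\<close> of the copies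
  and a budgeted longest common subsequence \<open>m\<close>. The bonus values have to be positive, so only
  the part of the arrangement where the last \<open>g\<close> coordinates are positive is searched. Each
  hyperplane where one of these coordinates vanishes compares two copies of the same tuple, so
  (if there is a tuple at all) a cell lies entirely inside or entirely outside this part.
  Without the restriction a cell with a negative bonus value can also be best.\<close>

definition mgra_candidate ::
    "(real ^ 'd) set \<Rightarrow> (real ^ 'd) list \<Rightarrow> nat \<Rightarrow>
     real ^ ('d::finite + 'g::finite) \<Rightarrow> ((real ^ 'd) \<times> 'g option) list \<Rightarrow> bool" where
  "mgra_candidate D \<pi> k u m \<longleftrightarrow>
     (\<exists>C \<rho>. C \<in> arrangement_cells (comparison_hyperplanes (tuple_copies D)) \<and>
        u \<in> C \<and> (\<forall>i. u $ Inr i > 0) \<and>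
        induced_ranking (tuple_copies D) C \<rho> \<and> budgeted_lcs k \<pi> \<rho> m)"

text \<open>The possible outputs of the algorithm. It is nondeterministic: which representative of a
  cell, which longest common subsequence and which of the best rankings is used is left open.\<close>

definition mgra_returns ::
    "(real ^ 'd) set \<Rightarrow> (real ^ 'd) list \<Rightarrow> nat \<Rightarrow>
     real ^ 'd \<Rightarrow> real ^ 'g \<Rightarrow> ('g \<Rightarrow> (real ^ 'd) set) \<Rightarrow> bool" where
  "mgra_returns D \<pi> k w v G \<longleftrightarrow>
     (\<exists>(u :: real ^ ('d::finite + 'g::finite)) m. mgra_candidate D \<pi> k u m \<and>
        (\<forall>(u' :: real ^ ('d::finite + 'g::finite)) m'. mgra_candidate D \<pi> k u' m' \<longrightarrow> length m' \<le> length m) \<and>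
        w = (\<chi> j. u $ Inl j) \<and> v = (\<chi> i. u $ Inr i) \<and>
        G = (\<lambda>i. {t. (t, Some i) \<in> set m}))"

end

theory Submission
  imports Defs
begin

text \<open>A solution \<open>(w, v, G)\<close> is a point \<open>u = (w, v)\<close> of \<open>\<real>\<^sup>d\<^sup>+\<^sup>g\<close> for which the copies of the tuples
  selected by \<open>G\<close> are strictly decreasing along \<open>\<pi>\<close>. These are finitely many open conditions on
  \<open>u\<close>, so \<open>u\<close> can be moved off all comparison hyperplanes; the cell reached in this way has a
  common subsequence with \<open>\<pi>\<close> that uses all of \<open>\<pi>\<close>. Hence a best cell also matches all of \<open>\<pi>\<close>,
  and such a matching read backwards is a solution.\<close>

section \<open>Strictly decreasing lists\<close>

text \<open>Two strictly decreasing lists leave no freedom in the order of their entries, so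
  inclusion of the sets is enough. This is how an order of the chosen copies becomes a common
  subsequence with \<rho>.\<close>

lemma subseq_if_sorted_wrt_greater:
  fixes f :: "'a \<Rightarrow> 'b::linorder"
  assumes "sorted_wrt (\<lambda>x y. f x > f y) xs" "sorted_wrt (\<lambda>x y. f x > f y) ys" "set xs \<subseteq> set ys"
  shows "subseq xs ys"
  using assms
proof (induction ys arbitrary: xs)
  case Nil
  then show ?case by simp
next
  case (Cons y ys)
  show ?case
  proof (cases xs)
    case Nil
    then show ?thesis by simp
  next
    case (Cons x xs')
    show ?thesis
    proof (cases "x = y")
      case True
      have "set xs' \<subseteq> set ys" using Cons.prems \<open>xs = x # xs'\<close> True by force
      then have "subseq xs' ys" using Cons.IH Cons.prems \<open>xs = x # xs'\<close> by auto
      then show ?thesis using \<open>xs = x # xs'\<close> True by simp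
    next
      case False
      \<comment> \<open>If the heads differ, \<open>x\<close> comes later in the longer list, so its
        key is below that of \<open>y\<close>. All entries of \<open>xs\<close> have keys at most
        \<open>f x\<close>, hence \<open>y\<close> can be skipped.\<close>
      have "f x < f y" using Cons.prems \<open>xs = x # xs'\<close> False by auto
      then have "y \<notin> set xs" using Cons.prems(1) \<open>xs = x # xs'\<close> by force
      then have "subseq xs ys" using Cons.IH[of xs] Cons.prems by auto
      then show ?thesis by (rule list_emb_Cons)
    qed
  qed
qed

lemma sorted_wrt_subseq:
  assumes "subseq xs ys" "sorted_wrt P ys"
  shows "sorted_wrt P xs"
  using assms by (induction rule: list_emb.induct) (auto dest: list_emb_set)

lemma ex_sorting_produces:
  assumes "finite A" "inj_on f A"
  shows "\<exists>xs. sorting_produces f A xs"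
proof -
  define ys where "ys = rev (sorted_list_of_set (f ` A))"
  \<comment> \<open>Sort the keys and pull them back; injectivity makes the preimages unique and
    rules out ties.\<close>
  define xs where "xs = map (inv_into A f) ys"
  have ys: "set ys = f ` A" "sorted_wrt (>) ys"
    using assms(1) by (simp_all add: ys_def sorted_wrt_rev)
  have "map f xs = ys"
    using ys(1) by (auto simp: xs_def f_inv_into_f intro!: map_idI)
  have "set xs = A"
    using ys(1) assms(2) by (simp add: xs_def)
  moreover have "distinct xs"
  proof -
    have "distinct (map f xs)" by (simp add: \<open>map f xs = ys\<close> ys_def)
    then show ?thesis by (simp add: distinct_map)
  qed
  moreover have "sorted_wrt (\<lambda>x y. f x > f y) xs"
    using ys(2) by (simp add: sorted_wrt_map flip: \<open>map f xs = ys\<close>)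
  ultimately show ?thesis
    by (auto simp: sorting_produces_def ranking_over_def)
qed

section \<open>Scores as inner products with copies\<close>

lemma inner_tuple_copy:
  fixes u :: "real ^ ('d::finite + 'g::finite)"
  shows "u \<bullet> tuple_copy t l =
    score (\<chi> j. u $ Inl j) t + (case l of None \<Rightarrow> 0 | Some i \<Rightarrow> u $ Inr i)"
  unfolding inner_vec_def tuple_copy_def score_def UNIV_Plus_UNIV[symmetric]
  by (subst sum.Plus) (auto split: option.split simp: if_distrib cong: if_cong)

text \<open>The assumption says that \<open>l\<close> names the only group containing
  \<open>t\<close>, if there is one, so the bonus sum collapses to the single coordinate that
  \<open>tuple_copy t l\<close> selects. Both directions of the correspondence between solutions and
  matchings rest on this.\<close>

lemma bonus_score_eq_inner_tuple_copy:
  fixes u :: "real ^ ('d::finite + 'g::finite)"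
  assumes "\<And>i. t \<in> G i \<longleftrightarrow> l = Some i"
  shows "bonus_score (\<chi> j. u $ Inl j) (\<chi> i. u $ Inr i) G t = u \<bullet> tuple_copy t l"
  unfolding bonus_score_def inner_tuple_copy assms by (cases l) auto

lemma finite_tuple_copies:
  assumes "finite D"
  shows "finite (tuple_copies D :: (real ^ ('d::finite + 'g::finite)) set)"
proof -
  have "tuple_copies D =
      (\<lambda>(t, l). tuple_copy t l :: real ^ ('d + 'g)) ` (D \<times> UNIV)"
    by (auto simp: tuple_copies_def)
  then show ?thesis using assms by simp
qed

section \<open>Generic points and cells of the arrangement\<close>

lemma negligible_Union_comparison_hyperplanes:
  fixes A :: "(real ^ ('d::finite + 'g::finite)) set"
  assumes "finite A"
  shows "negligible (\<Union>(comparison_hyperplanes A))"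
proof (rule negligible_Union)
  have "comparison_hyperplanes A \<subseteq> (\<lambda>(a, b). {u. u \<bullet> a = u \<bullet> b}) ` (A \<times> A)"
    by (auto simp: comparison_hyperplanes_def)
  then show "finite (comparison_hyperplanes A)"
    using assms by (meson finite_SigmaI finite_imageI finite_subset)
next
  fix h assume "h \<in> comparison_hyperplanes A"
  then obtain a b where "a \<noteq> b" and h: "h = {u. u \<bullet> a = u \<bullet> b}"
    by (auto simp: comparison_hyperplanes_def)
  have "h = {u. (a - b) \<bullet> u = 0}"
    unfolding h by (auto simp: inner_diff_left inner_commute[of a] inner_commute[of b])
  then show "negligible h"
    using negligible_hyperplane[of "a - b" 0] \<open>a \<noteq> b\<close> by simp
qed

text \<open>By the intermediate value theorem: a sign change of \<open>x \<bullet> (a - b)\<close>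
  on the connected set \<open>C\<close> would give a point of \<open>C\<close> on the hyperplane
  comparing \<open>a\<close> and \<open>b\<close>, but cells avoid all hyperplanes.\<close>

lemma inner_less_constant_on_cell:
  fixes A :: "(real ^ ('d::finite + 'g::finite)) set"
  assumes C: "C \<in> arrangement_cells (comparison_hyperplanes A)"
    and "u \<in> C" "u' \<in> C" and "a \<in> A" "b \<in> A" and less: "u \<bullet> a < u \<bullet> b"
  shows "u' \<bullet> a < u' \<bullet> b"
proof (rule ccontr)
  assume "\<not> u' \<bullet> a < u' \<bullet> b"
  then have "u \<bullet> (a - b) \<le> 0" "0 \<le> u' \<bullet> (a - b)"
    using less by (auto simp: inner_diff_right)
  moreover have "connected C"
    using C in_components_connected unfolding arrangement_cells_def by blast
  then have "connected ((\<lambda>x. x \<bullet> (a - b)) ` C)"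
    by (intro connected_continuous_image continuous_intros)
  ultimately have "0 \<in> (\<lambda>x. x \<bullet> (a - b)) ` C"
    using connectedD_interval \<open>u \<in> C\<close> \<open>u' \<in> C\<close> by blast
  then obtain x where "x \<in> C" "x \<bullet> a = x \<bullet> b"
    by (auto simp: inner_diff_right)
  moreover have "C \<subseteq> UNIV - \<Union>(comparison_hyperplanes A)"
    using C in_components_subset unfolding arrangement_cells_def by blast
  moreover have "a \<noteq> b" using less by auto
  ultimately show False
    using \<open>a \<in> A\<close> \<open>b \<in> A\<close> unfolding comparison_hyperplanes_def by blast
qed

lemma ex_cell_induced_ranking:
  fixes A :: "(real ^ ('d::finite + 'g::finite)) set"
  assumes "finite A" and u: "u \<notin> \<Union>(comparison_hyperplanes A)"
  shows "\<exists>C \<rho>. C \<in> arrangement_cells (comparison_hyperplanes A) \<and> u \<in> C \<and> induced_ranking A C \<rho>"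
proof -
  define C where "C = connected_component_set (UNIV - \<Union>(comparison_hyperplanes A)) u"
  have C: "C \<in> arrangement_cells (comparison_hyperplanes A)" and "u \<in> C"
    using u by (auto simp: C_def arrangement_cells_def intro!: componentsI)
  have "inj_on (\<lambda>a. u \<bullet> a) A"
    \<comment> \<open>A tie between two distinct points would put \<open>u\<close> on their
      comparison hyperplane.\<close>
    using u unfolding inj_on_def comparison_hyperplanes_def by blast
  then obtain \<rho> where \<rho>: "sorting_produces (\<lambda>a. u \<bullet> a) A \<rho>"
    using ex_sorting_produces \<open>finite A\<close> by blast
  have "sorting_produces (\<lambda>a. u' \<bullet> a) A \<rho>" if "u' \<in> C" for u'
    using \<rho> inner_less_constant_on_cell[OF C \<open>u \<in> C\<close> that]
    unfolding sorting_produces_def ranking_over_def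
    by (auto intro: sorted_wrt_mono_rel[rotated])
  then show ?thesis
    using C \<open>u \<in> C\<close> unfolding induced_ranking_def by blast
qed

text \<open>The strict inequalities cut out an open set around \<open>u\<close>. A nonempty open set
  has positive measure, so finitely many hyperplanes cannot cover it.\<close>

lemma ex_generic_sorted_wrt:
  fixes u :: "real ^ ('d::finite + 'g::finite)"
  assumes "finite A" and pos: "\<forall>i. u $ Inr i > 0"
    and sorted: "sorted_wrt (\<lambda>a b. u \<bullet> a > u \<bullet> b) xs"
  shows "\<exists>u'. u' \<notin> \<Union>(comparison_hyperplanes A) \<and> (\<forall>i. u' $ Inr i > 0) \<and>
    sorted_wrt (\<lambda>a b. u' \<bullet> a > u' \<bullet> b) xs"
proof -
  define S where "S = (\<Inter>i. {u :: real ^ ('d + 'g). u $ Inr i > 0}) \<inter>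
    (\<Inter>(i, j) \<in> {(i, j). i < j \<and> j < length xs}. {u. u \<bullet> xs ! i > u \<bullet> xs ! j})"
  have "finite {(i, j). i < j \<and> j < length xs}"
    by (rule finite_subset[of _ "{..<length xs} \<times> {..<length xs}"]) auto
  then have "open S"
    unfolding S_def
    by (intro open_Int open_INT) (auto intro!: open_Collect_less continuous_intros)
  moreover have "u \<in> S"
    using pos sorted by (auto simp: S_def sorted_wrt_iff_nth_less)
  ultimately have "\<not> negligible S"
    using open_not_negligible by blast
  then have "\<not> S \<subseteq> \<Union>(comparison_hyperplanes A)"
    using negligible_Union_comparison_hyperplanes[OF \<open>finite A\<close>] negligible_subset by blast
  then show ?thesis
    by (auto simp: S_def sorted_wrt_iff_nth_less)
qed

section \<open>Solutions and full matchings\<close>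

lemma ex_full_mgra_candidate:
  fixes w :: "real ^ 'd" and v :: "real ^ 'g"
  assumes "finite D" and sol: "group_bonus_solution D \<pi> k w v G"
  shows "\<exists>(u :: real ^ ('d + 'g)) m. mgra_candidate D \<pi> k u m \<and> length m = length \<pi>"
proof -
  define u :: "real ^ ('d + 'g)" where
    "u = (\<chi> c. case c of Inl j \<Rightarrow> w $ j | Inr i \<Rightarrow> v $ i)"
  have w: "w = (\<chi> j. u $ Inl j)" and v: "v = (\<chi> i. u $ Inr i)"
    by (simp_all add: u_def vec_eq_iff)
  from sol have pos: "\<forall>i. u $ Inr i > 0" and "\<forall>i. G i \<subseteq> D" and "disjoint_family G"
    and card: "(\<Sum>i\<in>UNIV. card (G i)) \<le> k"
    and "set \<pi> = D" "distinct \<pi>"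
    and sorted: "sorted_wrt (\<lambda>x y. bonus_score w v G x > bonus_score w v G y) \<pi>"
    by (auto simp: group_bonus_solution_def sorting_produces_def ranking_over_def u_def)
  \<comment> \<open>The label of the group containing \<open>t\<close>; disjointness makes the
    choice by \<open>SOME\<close> unique.\<close>
  define l where "l t = (if \<exists>i. t \<in> G i then Some (SOME i. t \<in> G i) else None)" for t
  have l: "t \<in> G i \<longleftrightarrow> l t = Some i" for t i
    using \<open>disjoint_family G\<close> someI[of "\<lambda>i. t \<in> G i"]
    unfolding l_def disjoint_family_on_def by (auto split: if_splits)
  define m where "m = map (\<lambda>t. (t, l t)) \<pi>"
  define c where "c = map (\<lambda>(p, l). tuple_copy p l :: real ^ ('d + 'g)) m"
  \<comment> \<open>The point \<open>u\<close> itself may lie on comparison hyperplanes, since only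
    the copies in \<open>c\<close> are known to be free of ties. Hence the move to
    \<open>u'\<close>.\<close>
  have "sorted_wrt (\<lambda>a b. u \<bullet> a > u \<bullet> b) c"
    using sorted unfolding w v bonus_score_eq_inner_tuple_copy[of _ G, OF l]
    by (simp add: c_def m_def sorted_wrt_map)
  then obtain u' where u': "u' \<notin> \<Union>(comparison_hyperplanes (tuple_copies D))"
      "\<forall>i. u' $ Inr i > 0" "sorted_wrt (\<lambda>a b. u' \<bullet> a > u' \<bullet> b) c"
    using ex_generic_sorted_wrt[OF finite_tuple_copies[OF \<open>finite D\<close>] pos] by blast
  then obtain C \<rho> where C: "C \<in> arrangement_cells (comparison_hyperplanes (tuple_copies D))"
      "u' \<in> C" "induced_ranking (tuple_copies D) C \<rho>"
    using ex_cell_induced_ranking[OF finite_tuple_copies[OF \<open>finite D\<close>]] by blast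
  have "set c \<subseteq> tuple_copies D"
    using \<open>set \<pi> = D\<close> by (auto simp: c_def m_def tuple_copies_def)
  then have "subseq c \<rho>"
    using C u'(3)
    by (intro subseq_if_sorted_wrt_greater[where f = "\<lambda>a. u' \<bullet> a"])
       (auto simp: induced_ranking_def sorting_produces_def ranking_over_def)
  moreover have "length (filter (\<lambda>(p, l). l \<noteq> None) m) \<le> k"
  proof -
    have "length (filter (\<lambda>(p, l). l \<noteq> None) m) = card {t \<in> set \<pi>. l t \<noteq> None}"
      using \<open>distinct \<pi>\<close> by (simp add: m_def filter_map o_def flip: distinct_card)
    also have "{t \<in> set \<pi>. l t \<noteq> None} = (\<Union>i. G i)"
      using l \<open>\<forall>i. G i \<subseteq> D\<close> \<open>set \<pi> = D\<close> by auto
    also have "card \<dots> \<le> (\<Sum>i\<in>UNIV. card (G i))"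
      by (rule card_UN_le) simp
    finally show ?thesis using card by simp
  qed
  ultimately have "budgeted_common_subseq k \<pi> \<rho> m"
    by (simp add: budgeted_common_subseq_def c_def m_def o_def)
  \<comment> \<open>The first components of any common subsequence form a subsequence of \<pi>, and
    \<open>m\<close> already has the length of \<pi>.\<close>
  moreover have "length m' \<le> length m" if "budgeted_common_subseq k \<pi> \<rho> m'" for m'
    using that list_emb_length[of "(=)" "map fst m'" \<pi>]
    by (simp add: budgeted_common_subseq_def m_def)
  ultimately have "mgra_candidate D \<pi> k u' m"
    using C u'(2) unfolding mgra_candidate_def budgeted_lcs_def by blast
  moreover have "length m = length \<pi>" by (simp add: m_def)
  ultimately show ?thesis by blast
qed

lemma length_mgra_candidate_le:
  assumes "mgra_candidate D \<pi> k u m"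
  shows "length m \<le> length \<pi>"
proof -
  have "subseq (map fst m) \<pi>"
    using assms
    by (auto simp: mgra_candidate_def budgeted_lcs_def budgeted_common_subseq_def)
  then show ?thesis
    using list_emb_length by fastforce
qed

lemma full_mgra_candidate_group_bonus_solution:
  fixes u :: "real ^ ('d::finite + 'g::finite)"
  assumes "ranking_over D \<pi>" and cand: "mgra_candidate D \<pi> k u m" and len: "length m = length \<pi>"
  shows "group_bonus_solution D \<pi> k (\<chi> j. u $ Inl j) (\<chi> i. u $ Inr i) (\<lambda>i. {t. (t, Some i) \<in> set m})"
proof -
  define G where "G = (\<lambda>i. {t. (t, Some i) \<in> set m})"
  from cand obtain C \<rho> where "u \<in> C" and pos: "\<forall>i. u $ Inr i > 0"
      and "induced_ranking (tuple_copies D) C \<rho>" and "subseq (map fst m) \<pi>"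
      and sub: "subseq (map (\<lambda>(p, l). tuple_copy p l) m) \<rho>"
      and budget: "length (filter (\<lambda>(p, l). l \<noteq> None) m) \<le> k"
    by (auto simp: mgra_candidate_def budgeted_lcs_def budgeted_common_subseq_def)
  \<comment> \<open>A subsequence of full length is the whole list. As \<pi> is distinct,
    \<open>m\<close> then gives every tuple exactly one label, which yields disjoint groups and
    well-defined scores.\<close>
  have \<pi>: "map fst m = \<pi>"
    using \<open>subseq (map fst m) \<pi>\<close> len by (intro subseq_same_length) auto
  have "set \<pi> = D" "distinct (map fst m)"
    using assms(1) \<pi> by (auto simp: ranking_over_def)
  have uniq: "l = l'" if "(t, l) \<in> set m" "(t, l') \<in> set m" for t l l'
    using eq_key_imp_eq_value[OF \<open>distinct (map fst m)\<close> that] .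
  have score: "bonus_score (\<chi> j. u $ Inl j) (\<chi> i. u $ Inr i) G t = u \<bullet> tuple_copy t l"
    if "(t, l) \<in> set m" for t l
    by (rule bonus_score_eq_inner_tuple_copy) (use that uniq in \<open>auto simp: G_def\<close>)
  have "sorted_wrt (\<lambda>a b. u \<bullet> a > u \<bullet> b) \<rho>"
    using \<open>u \<in> C\<close> \<open>induced_ranking (tuple_copies D) C \<rho>\<close>
    by (auto simp: induced_ranking_def sorting_produces_def)
  then have "sorted_wrt (\<lambda>a b. u \<bullet> a > u \<bullet> b) (map (\<lambda>(p, l). tuple_copy p l) m)"
    using sub by (meson sorted_wrt_subseq)
  then have "sorted_wrt (\<lambda>(s, l) (t, l'). u \<bullet> tuple_copy s l > u \<bullet> tuple_copy t l') m"
    by (simp add: sorted_wrt_map case_prod_unfold)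
  then have "sorted_wrt (\<lambda>x y. bonus_score (\<chi> j. u $ Inl j) (\<chi> i. u $ Inr i) G (fst x) >
      bonus_score (\<chi> j. u $ Inl j) (\<chi> i. u $ Inr i) G (fst y)) m"
    by (rule sorted_wrt_mono_rel[rotated]) (auto simp: score)
  then have "sorting_produces (bonus_score (\<chi> j. u $ Inl j) (\<chi> i. u $ Inr i) G) D \<pi>"
    using assms(1) by (simp add: sorting_produces_def sorted_wrt_map flip: \<pi>)
  moreover have "G i \<subseteq> D" for i
    using \<open>set \<pi> = D\<close> \<pi> by (force simp: G_def)
  moreover have "disjoint_family G"
    using uniq by (force simp: G_def disjoint_family_on_def)
  moreover have "(\<Sum>i\<in>UNIV. card (G i)) \<le> k"
  proof -
    have "finite (G i)" for i
      using \<open>G i \<subseteq> D\<close> \<open>set \<pi> = D\<close> finite_subset by blast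
    then have "(\<Sum>i\<in>UNIV. card (G i)) = card (\<Union>i. G i)"
      using \<open>disjoint_family G\<close>
      by (intro card_UN_disjoint[symmetric]) (auto simp: disjoint_family_on_def)
    \<comment> \<open>Each member of a group is the first component of an entry with a label other
      than \<open>None\<close>, and the budget bounds the number of these entries.\<close>
    also have "\<dots> \<le> card (set (map fst (filter (\<lambda>(p, l). l \<noteq> None) m)))"
      by (intro card_mono) (force simp: G_def)+
    also have "\<dots> \<le> length (filter (\<lambda>(p, l). l \<noteq> None) m)"
      using card_length[of "map fst (filter (\<lambda>(p, l). l \<noteq> None) m)"] by simp
    finally show ?thesis using budget by simp
  qed
  ultimately show ?thesis
    using pos unfolding group_bonus_solution_def G_def by simp
qed

theorem theoremD2:
  fixes D :: "(real ^ 'd) set" and \<pi> :: "(real ^ 'd) list" and k :: nat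
  assumes "finite D" and "ranking_over D \<pi>" and "k > 0"
    and "\<exists>(w :: real ^ 'd) (v :: real ^ 'g) G. group_bonus_solution D \<pi> k w v G"
  shows "(\<exists>(w :: real ^ 'd) (v :: real ^ 'g) G. mgra_returns D \<pi> k w v G) \<and>
    (\<forall>(w :: real ^ 'd) (v :: real ^ 'g) G.
       mgra_returns D \<pi> k w v G \<longrightarrow> group_bonus_solution D \<pi> k w v G)"
proof -
  obtain u :: "real ^ ('d + 'g)" and m
    where um: "mgra_candidate D \<pi> k u m" "length m = length \<pi>"
    using assms(4) ex_full_mgra_candidate[OF \<open>finite D\<close>] by blast
  show ?thesis
  proof (intro conjI allI impI)
    show "\<exists>(w :: real ^ 'd) (v :: real ^ 'g) G. mgra_returns D \<pi> k w v G"
      \<comment> \<open>No candidate is longer than \<pi>, so the full one is best.\<close>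
      using um length_mgra_candidate_le unfolding mgra_returns_def by metis
  next
    fix w :: "real ^ 'd" and v :: "real ^ 'g" and G
    assume "mgra_returns D \<pi> k w v G"
    then obtain u' :: "real ^ ('d + 'g)" and m' where
        u': "mgra_candidate D \<pi> k u' m'" and "length m \<le> length m'"
        and wvG: "w = (\<chi> j. u' $ Inl j)" "v = (\<chi> i. u' $ Inr i)"
          "G = (\<lambda>i. {t. (t, Some i) \<in> set m'})"
      using um(1) unfolding mgra_returns_def by blast
    \<comment> \<open>A best candidate is at least as long as the full candidate \<open>m\<close>,
      so it is full too.\<close>
    then have "length m' = length \<pi>"
      using um(2) length_mgra_candidate_le[OF u'] by simp
    then show "group_bonus_solution D \<pi> k w v G"
      unfolding wvG by (rule full_mgra_candidate_group_bonus_solution[OF assms(2) u'])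
  qed
qed

end
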